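(* Let $x$ be a factor of the Thue--Morse word $\mathbf{t}$ that begins with $1001$ and ends with $1001$, i.e. $x = 1001x'' = x'1001$ for some words $x', x''$. Then the word $x0x0$ is cubefree.
   Context: Let $\mu$ be the morphism on $\{0,1\}^*$ with $\mu(0)=01$, $\mu(1)=10$. The Thue--Morse word $\mathbf{t} = 011010011001011010010110\cdots$ is the infinite word obtained by iterating $\mu$ on $0$. A factor is a contiguous finite subword. A cube is a non-empty word of the form $uuu$; a word is cubefree if none of its factors is a cube. *)

theory Defs
  imports "HOL-Library.Z2" "HOL-Library.Sublist"
begin

fun mu_letter :: "bit \<Rightarrow> bit list" where
  "mu_letter 0 = [0, 1]"
| "mu_letter 1 = [1, 0]"

definition mu :: "bit list \<Rightarrow> bit list" where
  "mu w = concat (map mu_letter w)"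

text \<open>
  The word obtained by applying \<^const>\<open>mu\<close> to the single letter 0 for \<open>k\<close> times has length
  \<open>2 ^ k\<close> and is a prefix of all later iterates, so letter \<open>n\<close> of the limit word can be read off
  any iterate with \<open>n < 2 ^ k\<close>, in particular off the one with \<open>k = n\<close>; see
  \<open>nth_mu_iterate\<close> below.
\<close>

definition thue_morse :: "nat \<Rightarrow> bit" where
  "thue_morse n = (mu ^^ n) [0] ! n"

definition factor_of_inf :: "bit list \<Rightarrow> (nat \<Rightarrow> bit) \<Rightarrow> bool" where
  "factor_of_inf x w \<longleftrightarrow> (\<exists>i n. x = map w [i..<i + n])"

definition is_cube :: "'a list \<Rightarrow> bool" where
  "is_cube w \<longleftrightarrow> (\<exists>u. u \<noteq> [] \<and> w = u @ u @ u)"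

definition cubefree :: "'a list \<Rightarrow> bool" where
  "cubefree w \<longleftrightarrow> (\<forall>v. sublist v w \<longrightarrow> \<not> is_cube v)"

lemma mu_append: "mu (u @ v) = mu u @ mu v"
  by (simp add: mu_def)

lemma length_mu: "length (mu w) = 2 * length w"
proof (induction w)
  case (Cons a w)
  then show ?case by (cases a) (simp_all add: mu_def)
qed (simp add: mu_def)

lemma length_mu_iterate: "length ((mu ^^ k) [0]) = 2 ^ k"
  by (induction k) (simp_all add: length_mu)

lemma prefix_mu_iterate_Suc: "prefix ((mu ^^ k) [0]) ((mu ^^ Suc k) [0])"
proof (induction k)
  case 0
  show ?case by (simp add: mu_def)
next
  case (Suc k)
  then obtain v where "(mu ^^ Suc k) [0] = (mu ^^ k) [0] @ v"
    by (auto simp: prefix_def)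
  then have "mu ((mu ^^ Suc k) [0]) = mu ((mu ^^ k) [0]) @ mu v"
    by (simp only: mu_append)
  then show ?case by simp
qed

lemma prefix_mu_iterate: "k \<le> l \<Longrightarrow> prefix ((mu ^^ k) [0]) ((mu ^^ l) [0])"
proof (induction l rule: dec_induct)
  case (step l)
  then show ?case
    using prefix_mu_iterate_Suc prefix_order.trans by blast
qed simp

lemma nth_mu_iterate:
  assumes "n < 2 ^ k"
  shows "(mu ^^ k) [0] ! n = thue_morse n"
proof (cases "k \<le> n")
  case True
  with prefix_mu_iterate obtain v where "(mu ^^ n) [0] = (mu ^^ k) [0] @ v"
    by (auto simp: prefix_def)
  with assms show ?thesis
    by (simp add: thue_morse_def nth_append length_mu_iterate)
next
  case False
  with prefix_mu_iterate[of n k] obtain v where "(mu ^^ k) [0] = (mu ^^ n) [0] @ v"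
    by (auto simp: prefix_def)
  then show ?thesis
    by (simp add: thue_morse_def nth_append length_mu_iterate)
qed

end

theory Submission
  imports Defs
begin

text \<open>
  The Thue--Morse word contains no overlap, that is, no factor of length \<open>2 * p + 1\<close> with period
  \<open>p\<close>; in particular \<open>01010\<close> does not occur in \<open>x\<close>. Around the middle \<open>0\<close> of \<open>x0x0\<close> however one
  reads \<open>100101001\<close>, with \<open>01010\<close> in its centre. A cube of period \<open>p \<ge> 4\<close> that misses part of this
  \<open>01010\<close> leaves at least \<open>2 * p + 1\<close> letters inside one copy of \<open>x\<close>, which is an overlap. A cube
  that contains it also contains a copy of \<open>01010\<close> shifted by \<open>p\<close> to the left or to the right,
  which lies inside \<open>x\<close> or at the end of \<open>x0\<close>, and the latter ends with \<open>10010\<close>. The periods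
  \<open>1, 2, 3\<close> are excluded by the letters around the middle.
\<close>

section \<open>Letters of the Thue-Morse word at even and odd positions\<close>

lemma nth_mu:
  assumes "n < length w"
  shows "mu w ! (2 * n) = w ! n" and "mu w ! Suc (2 * n) = w ! n + 1"
proof -
  have "mu w ! (2 * n) = w ! n \<and> mu w ! Suc (2 * n) = w ! n + 1"
    using assms
  proof (induction w arbitrary: n)
    case (Cons a w)
    show ?case
    proof (cases n)
      case 0
      then show ?thesis by (cases a) (simp_all add: mu_def)
    next
      case (Suc m)
      with Cons show ?thesis by (cases a) (simp_all add: mu_def)
    qed
  qed simp
  then show "mu w ! (2 * n) = w ! n" "mu w ! Suc (2 * n) = w ! n + 1" by simp_all
qed

text \<open>Iterate \<open>Suc n\<close> is \<open>mu\<close> of iterate \<open>n\<close>, which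
  already reaches position \<open>n\<close> because \<open>n < 2 ^ n\<close>. In \<open>bit\<close>,
  adding 1 is complementation.\<close>

lemma thue_morse_double: "thue_morse (2 * n) = thue_morse n"
  and thue_morse_Suc_double: "thue_morse (Suc (2 * n)) = thue_morse n + 1"
proof -
  have n: "n < 2 ^ n" by (rule less_exp)
  then have "2 * n < 2 ^ Suc n" "Suc (2 * n) < 2 ^ Suc n"
    by (simp_all only: power_Suc)
  from this[THEN nth_mu_iterate, symmetric]
  show "thue_morse (2 * n) = thue_morse n" "thue_morse (Suc (2 * n)) = thue_morse n + 1"
    using n by (simp_all add: nth_mu nth_mu_iterate length_mu_iterate)
qed

lemma thue_morse_Suc_neq: "even n \<Longrightarrow> thue_morse (Suc n) \<noteq> thue_morse n"
  by (elim evenE) (simp add: thue_morse_double thue_morse_Suc_double)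

lemma bit_neq_trans: "a \<noteq> b \<Longrightarrow> b \<noteq> c \<Longrightarrow> a = (c :: bit)"
  by (cases a; cases b; cases c) simp_all

text \<open>One of \<open>i\<close> and \<open>i + 1\<close> is even, and the block
  \<open>01\<close> or \<open>10\<close> starting there has two different letters.\<close>

lemma thue_morse_no_three_equal:
  "\<not> (thue_morse i = thue_morse (i + 1) \<and> thue_morse (i + 1) = thue_morse (i + 2))"
  using thue_morse_Suc_neq[of i] thue_morse_Suc_neq[of "Suc i"] by (cases "even i") auto

text \<open>Seven alternating letters would give equal letters at three consecutive even positions,
  hence, by halving, three equal adjacent letters.\<close>

lemma thue_morse_not_alternating:
  "\<exists>j<6. thue_morse (i + j) = thue_morse (Suc (i + j))"
proof (rule ccontr)
  assume "\<not> ?thesis"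
  then have alt: "thue_morse (i + j) \<noteq> thue_morse (Suc (i + j))" if "j < 6" for j
    using that by blast
  have step: "thue_morse (i + j) = thue_morse (i + j + 2)" if "j < 5" for j
    using bit_neq_trans[OF alt[of j] alt[of "Suc j", simplified]] that by simp
  obtain m where "2 * m = i \<or> 2 * m = i + 1"
    by (metis even_Suc evenE Suc_eq_plus1)
  then obtain d where d: "d \<le> 1" "2 * m = i + d" by (metis add_0_right le_refl zero_le)
  have "thue_morse (2 * m) = thue_morse (2 * (m + 1))"
    "thue_morse (2 * (m + 1)) = thue_morse (2 * (m + 2))"
    using step[of d] step[of "d + 2"] d by (simp_all add: add.assoc)
  then have "thue_morse m = thue_morse (m + 1) \<and> thue_morse (m + 1) = thue_morse (m + 2)"
    by (simp only: thue_morse_double)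
  with thue_morse_no_three_equal show False by blast
qed

text \<open>Strong induction on the period: an even \<open>p\<close> is halved by looking at every
  second position, while an odd \<open>p\<close> forces an alternating stretch.\<close>

lemma thue_morse_overlap_free:
  assumes "p > 0"
  shows "\<exists>j\<le>p. thue_morse (i + j) \<noteq> thue_morse (i + j + p)"
  using assms
proof (induction p arbitrary: i rule: less_induct)
  case (less p)
  show ?case
  proof (rule ccontr)
    assume "\<not> ?thesis"
    then have per: "thue_morse (i + j) = thue_morse (i + j + p)" if "j \<le> p" for j
      using that by blast
    show False
    proof (cases "even p")
      case True
      then obtain q where q: "p = 2 * q" by (elim evenE)
      with less.prems have "q < p" "q > 0" by simp_all
      from less.IH[OF this, of "i div 2"] obtain j where j: "j \<le> q"
        "thue_morse (i div 2 + j) \<noteq> thue_morse (i div 2 + j + q)" by blast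
      \<comment> \<open>Both positions have the parity of \<open>i\<close>, so their letters are
        those at the halved positions, both complemented if \<open>i\<close> is odd.\<close>
      have "thue_morse (i + 2 * j) \<noteq> thue_morse (i + 2 * j + p)"
      proof (cases "even i")
        case True
        then obtain m where m: "i = 2 * m" by (elim evenE)
        then have "i + 2 * j = 2 * (m + j)" "i + 2 * j + p = 2 * (m + j + q)"
          using q by simp_all
        then show ?thesis using j(2) m by (simp only: thue_morse_double) simp
      next
        case False
        then obtain m where m: "i = 2 * m + 1" by (elim oddE)
        then have "i + 2 * j = Suc (2 * (m + j))" "i + 2 * j + p = Suc (2 * (m + j + q))"
          using q by simp_all
        then show ?thesis using j(2) m by (simp only: thue_morse_Suc_double add_right_cancel) simp
      qed
      with per[of "2 * j"] j(1) q show False by simp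
    next
      case False
      text \<open>For odd \<open>p\<close> one of two adjacent pairs at distance \<open>p\<close> starts at an even position.\<close>
      have *: "thue_morse (i + j) \<noteq> thue_morse (Suc (i + j)) \<and>
          thue_morse (i + j + p) \<noteq> thue_morse (Suc (i + j + p))" if "j < p" for j
        using per[of j] per[of "Suc j"] that thue_morse_Suc_neq[of "i + j"]
          thue_morse_Suc_neq[of "i + j + p"] False by (cases "even (i + j)") auto
      \<comment> \<open>The second half of \<open>*\<close> continues the alternation past
        \<open>p\<close>; this gives at least six pairs once \<open>p \<ge> 3\<close>.\<close>
      have alt: "thue_morse (i + j) \<noteq> thue_morse (Suc (i + j))" if "j < 2 * p" for j
        using *[of j] *[of "j - p"] that by (cases "j < p") auto
      show False
      proof (cases "p = 1")
        case True
        then show False using per[of 0] *[of 0] by simp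
      next
        case False
        with \<open>odd p\<close> have "p \<ge> 3" by presburger
        then show False using thue_morse_not_alternating[of i] alt by force
      qed
    qed
  qed
qed

section \<open>Overlaps in factors and periods of cubes\<close>

lemma factor_overlap_free:
  assumes "factor_of_inf x thue_morse" "p > 0" "c + 2 * p < length x"
  shows "\<exists>j\<le>p. x ! (c + j) \<noteq> x ! (c + j + p)"
proof -
  obtain k n where x: "x = map thue_morse [k..<k + n]"
    using assms(1) by (auto simp: factor_of_inf_def)
  have "x ! j = thue_morse (k + j)" if "j < length x" for j
    using that x by simp
  with thue_morse_overlap_free[OF assms(2), of "k + c"] assms(3) show ?thesis
    by (force simp: add.assoc)
qed

lemma nth_period_cube:
  assumes "length ys \<le> j" "j < length ys + 2 * length u"
  shows "(ys @ u @ u @ u @ zs) ! j = (ys @ u @ u @ u @ zs) ! (j + length u)"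
proof -
  obtain i where "j = length ys + i" using assms(1) le_Suc_ex by blast
  with assms(2) show ?thesis
    by (cases "i < length u") (simp_all add: nth_append)
qed

theorem theorem6:
  fixes x x' x'' :: "bit list"
  assumes "factor_of_inf x thue_morse"
    and "x = [1, 0, 0, 1] @ x''"
    and "x = x' @ [1, 0, 0, 1]"
  shows "cubefree (x @ [0] @ x @ [0])"
  unfolding cubefree_def
proof (intro allI impI notI)
  fix v
  define w where "w = x @ [0] @ x @ [0]"
  define n where "n = length x"
  assume "sublist v (x @ [0] @ x @ [0])" "is_cube v"
  then obtain ys u zs where "u \<noteq> []" and w: "w = ys @ u @ u @ u @ zs"
    by (auto simp: sublist_def is_cube_def w_def)
  define s p where "s = length ys" and "p = length u"
  have "p > 0" using \<open>u \<noteq> []\<close> by (simp add: p_def)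
  have "length w = 2 * n + 2" by (simp add: w_def n_def)
  then have len: "s + 3 * p \<le> 2 * n + 2" by (simp add: w s_def p_def)
  have per: "w ! j = w ! (j + p)" if "s \<le> j" "j < s + 2 * p" for j
    unfolding w p_def by (rule nth_period_cube) (use that in \<open>simp_all add: s_def p_def\<close>)

  \<comment> \<open>The copies of \<open>x\<close> occupy positions \<open>0\<close> to
    \<open>n - 1\<close> and \<open>n + 1\<close> to \<open>2 * n\<close>; the added zeros sit at
    \<open>n\<close> and \<open>2 * n + 1\<close>.\<close>
  have left: "w ! j = x ! j" if "j < n" for j
    using that by (simp add: w_def n_def nth_append)
  have right: "w ! (n + 1 + j) = x ! j" if "j < n" for j
    using that by (simp add: w_def n_def nth_append)
  have "n \<ge> 4" using assms(2) by (simp add: n_def)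
  have first: "x ! 0 = 1" "x ! 1 = 0" "x ! 2 = 0" "x ! 3 = 1"
    using assms(2) by simp_all
  have n': "n = length x' + 4" using assms(3) by (simp add: n_def)
  have last: "x ! (n - 4) = 1" "x ! (n - 3) = 0" "x ! (n - 2) = 0" "x ! (n - 1) = 1"
    using assms(3) by (simp_all add: n' nth_append)
  have zeros: "w ! n = 0" "w ! (2 * n + 1) = 0"
    by (simp_all add: w_def n_def nth_append)
  have mid: "w ! (n - 4) = 1" "w ! (n - 3) = 0" "w ! (n - 2) = 0" "w ! (n - 1) = 1"
    "w ! n = 0" "w ! (n + 1) = 1" "w ! (n + 2) = 0" "w ! (n + 3) = 0" "w ! (n + 4) = 1"
    using left[of "n - 4"] left[of "n - 3"] left[of "n - 2"] left[of "n - 1"]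
      right[of 0] right[of 1] right[of 2] right[of 3] first last zeros \<open>n \<ge> 4\<close>
    by (simp_all add: eval_nat_numeral)
  have "n + 1 + (n - 4) = 2 * n - 3" "n + 1 + (n - 1) = 2 * n"
    using \<open>n \<ge> 4\<close> by simp_all
  then have fin: "w ! (2 * n - 3) = 1" "w ! (2 * n) = 1" "w ! (2 * n + 1) = 0"
    using right[of "n - 4"] right[of "n - 1"] last zeros \<open>n \<ge> 4\<close>
    by (simp_all add: mult_2)

  have ovl: "\<exists>j\<le>q. x ! (c + j) \<noteq> x ! (c + j + q)" if "q > 0" "c + 2 * q < n" for c q
    using factor_overlap_free[OF assms(1)] that by (simp add: n_def)
  \<comment> \<open>The \<open>2 * p + 1\<close> letters from \<open>c\<close> on lie in the first
    copy of \<open>x\<close>, and \<open>c < s + p\<close> keeps them inside the cube.\<close>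
  have not_left: False if c: "s \<le> c" "c + 2 * p < n" "c < s + p" for c
  proof -
    obtain j where "j \<le> p" "x ! (c + j) \<noteq> x ! (c + j + p)"
      using ovl[OF \<open>p > 0\<close> c(2)] by blast
    moreover have "w ! (c + j) = w ! (c + j + p)"
      using per[of "c + j"] c \<open>j \<le> p\<close> \<open>p > 0\<close> by linarith
    ultimately show False using c left[of "c + j"] left[of "c + j + p"] by simp
  qed
  have not_right: False if c: "s \<le> c" "n + 1 \<le> c" "c + 2 * p \<le> 2 * n" "c < s + p" for c
  proof -
    obtain d where d: "c = n + 1 + d" using c(2) le_Suc_ex by blast
    with c(3) have "d + 2 * p < n" by linarith
    then obtain j where "j \<le> p" "x ! (d + j) \<noteq> x ! (d + j + p)"
      using ovl[OF \<open>p > 0\<close>] by blast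
    moreover have "w ! (c + j) = w ! (c + j + p)"
      using per[of "c + j"] c \<open>j \<le> p\<close> by linarith
    ultimately show False
      using d \<open>d + 2 * p < n\<close> right[of "d + j"] right[of "d + j + p"] by (simp add: add.assoc)
  qed
  \<comment> \<open>The letters \<open>01010\<close> from position \<open>n - 2\<close> on are an
    overlap of period 2, so no copy of them fits inside \<open>x\<close>.\<close>
  have no_middle: False if c: "c + 4 < n" "\<And>j. j \<le> 4 \<Longrightarrow> x ! (c + j) = w ! (n - 2 + j)" for c
  proof -
    obtain j where "j \<le> 2" "x ! (c + j) \<noteq> x ! (c + (j + 2))"
      using ovl[of 2 c] c(1) by (auto simp: add.assoc)
    then have "w ! (n - 2 + j) \<noteq> w ! (n - 2 + (j + 2))"
      using c(2)[of j] c(2)[of "j + 2"] by simp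
    moreover from \<open>j \<le> 2\<close> have "j = 0 \<or> j = 1 \<or> j = 2" by linarith
    moreover have "n - 2 + 1 = n - 1" "n - 2 + 2 = n" "n - 2 + 3 = n + 1" "n - 2 + 4 = n + 2"
      using \<open>n \<ge> 4\<close> by simp_all
    ultimately show False using mid by auto
  qed

  \<comment> \<open>Case analysis on the period of the cube\<close>
  consider "p = 1" | "p = 2" | "p = 3" | "p \<ge> 4" using \<open>p > 0\<close> by linarith
  then show False
  proof cases
    case 1
    consider "s + 3 \<le> n" | "s \<le> n - 1" "n - 1 < s + 2" | "s = n" | "n + 1 \<le> s" "s + 1 < 2 * n"
      | "s = 2 * n - 1"
      using len 1 \<open>n \<ge> 4\<close> by linarith
    then show ?thesis
    proof cases
      case 1
      then show ?thesis using not_left[of s] \<open>p = 1\<close> by simp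
    next
      case 2
      then show ?thesis using per[of "n - 1"] mid \<open>p = 1\<close> \<open>n \<ge> 4\<close> by simp
    next
      case 3
      then show ?thesis using per[of n] mid \<open>p = 1\<close> by simp
    next
      case 4
      then show ?thesis using not_right[of s] \<open>p = 1\<close> by simp
    next
      case 5
      then show ?thesis using per[of "2 * n"] fin \<open>p = 1\<close> \<open>n \<ge> 4\<close> by simp
    qed
  next
    case 2
    consider "s + 6 \<le> n + 1" | "s \<le> n - 3" "n - 3 < s + 4" | "n - 2 \<le> s" "s \<le> n" | "n + 1 \<le> s"
      using \<open>n \<ge> 4\<close> by linarith
    then show ?thesis
    proof cases
      case 1
      then show ?thesis using not_left[of s] 1 \<open>p = 2\<close> by simp
    next
      case 2
      have "n - 3 + 2 = n - 1" using \<open>n \<ge> 4\<close> by simp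
      then show ?thesis using per[of "n - 3"] mid 2 \<open>p = 2\<close> by simp
    next
      case 3
      then have "w ! (n + 1) = w ! (n + 1 + 2)"
        using per[of "n + 1"] \<open>p = 2\<close> by simp
      moreover have "n + 1 + 2 = n + 3" by simp
      ultimately show ?thesis using mid by (metis zero_neq_one)
    next
      case 4
      then show ?thesis using not_right[of s] len \<open>p = 2\<close> by simp
    qed
  next
    case 3
    consider "s + 9 \<le> n + 2" | "s \<le> n - 2" "n - 2 < s + 6" | "s = n - 1" | "n \<le> s"
      using \<open>n \<ge> 4\<close> by linarith
    then show ?thesis
    proof cases
      case 1
      then show ?thesis using not_left[of s] 1 \<open>p = 3\<close> by simp
    next
      case 2
      have "n - 2 + 3 = n + 1" using \<open>n \<ge> 4\<close> by simp
      then show ?thesis using per[of "n - 2"] mid 2 \<open>p = 3\<close> by simp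
    next
      case 3
      have "n - 1 + 3 = n + 2" using \<open>n \<ge> 4\<close> by simp
      then show ?thesis using per[of "n - 1"] mid 3 \<open>p = 3\<close> by simp
    next
      case 4
      \<comment> \<open>If \<open>s = n\<close>, the overlap is taken one letter later, past the
        middle zero.\<close>
      then show ?thesis using not_right[of "max s (n + 1)"] len \<open>p = 3\<close> by linarith
    qed
  next
    case 4
    \<comment> \<open>In the first two cases at most three letters of the cube lie outside one copy
      of \<open>x\<close>, and \<open>3 * p - 3 \<ge> 2 * p + 1\<close>. In the third the cube
      covers \<open>n - 2\<close> to \<open>n + 2\<close>, the place of
      \<open>01010\<close>.\<close>
    consider "s + 3 * p \<le> n + 2" | "n \<le> s + 1" | "s + 2 \<le> n" "n + 3 \<le> s + 3 * p" by linarith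
    then show ?thesis
    proof cases
      case 1
      then show ?thesis using not_left[of s] 1 \<open>p \<ge> 4\<close> by simp
    next
      case 2
      then show ?thesis using not_right[of "max s (n + 1)"] len 2 \<open>p \<ge> 4\<close> by linarith
    next
      case 3
      show ?thesis
      proof (cases "n - 2 < s + p")
        case True
        \<comment> \<open>Since \<open>01010\<close> starts in the first period of the cube, its
          copy \<open>p\<close> to the right is still in the cube.\<close>
        have eq: "w ! (n - 2 + j) = w ! (n - 2 + j + p)" if "j \<le> 4" for j
          using per[of "n - 2 + j"] True 3 4 that by linarith
        have "p + 1 \<le> n" using True 3 4 len by linarith
        then consider "p + 1 = n" | "p + 2 \<le> n" by linarith
        then show ?thesis
        proof cases
          case 1
          \<comment> \<open>The shifted copy would be the last five letters of \<open>w\<close>,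
            which begin with \<open>1\<close> instead of \<open>0\<close>.\<close>
          then have "n - 2 + p = 2 * n - 3" using \<open>n \<ge> 4\<close> by simp
          then show ?thesis using eq[of 0] mid fin by simp
        next
          case 2
          \<comment> \<open>Position \<open>n - 2 + p\<close> of \<open>w\<close> is position
            \<open>p - 3\<close> of the second copy of \<open>x\<close>.\<close>
          have "x ! (p - 3 + j) = w ! (n - 2 + j)" if "j \<le> 4" for j
          proof -
            have "n + 1 + (p - 3 + j) = n - 2 + j + p" using 4 \<open>n \<ge> 4\<close> by simp
            then show ?thesis using right[of "p - 3 + j"] eq[OF that] that 2 4 by simp
          qed
          from no_middle[OF _ this] 2 4 show ?thesis by simp
        qed
      next
        case False
        \<comment> \<open>Now the copy \<open>p\<close> to the left starts no earlier than
          \<open>s\<close>, and \<open>p \<ge> 4\<close> puts it inside the first copy of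
          \<open>x\<close>.\<close>
        have "x ! (n - 2 - p + j) = w ! (n - 2 + j)" if "j \<le> 4" for j
        proof -
          have "n - 2 - p + j + p = n - 2 + j" using False by simp
          then show ?thesis
            using per[of "n - 2 - p + j"] left[of "n - 2 - p + j"] that False 3 4 by simp
        qed
        moreover have "n - 2 - p + 4 < n" using False 4 by linarith
        ultimately show ?thesis using no_middle by blast
      qed
    qed
  qed
qed

end
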